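(* Let $(x_i,y_i)_{i\in[n]}$ be i.i.d. input-output pairs in $\mathbb R^d\times[-1,1]$ such that: (1) the distribution $\mu$ of the covariates $x_i$ can be written as $\mu=\sum_{\ell=1}^k\alpha_\ell\mu_\ell$, where each $\mu_\ell$ satisfies $c$-isoperimetry, $\alpha_\ell\ge0$, $\sum_\ell\alpha_\ell=1$; (2) $\sigma^2\equiv\mathbb E^{\mu}[\mathrm{Var}(y\mid x)]>0$. Let $L>0$, $\epsilon>0$, and let $\mathcal F$ be a finite class of $L$-Lipschitz functions $\mathbb R^d\to\mathbb R$. Then \[ \mathbb P\Big(\exists f\in\mathcal F:\ \tfrac1n\sum_{i=1}^n(y_i-f(x_i))^2\le\sigma^2-\epsilon\Big)\le 4k\exp\Big(-\frac{n\epsilon^2}{8^3k}\Big)+2\exp\Big(\log|\mathcal F|-\frac{\epsilon^2nd}{10^4cL^2}\Big). \]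
   Context: A probability measure $\nu$ on $\mathbb R^d$ satisfies $c$-isoperimetry if for every bounded $L$-Lipschitz (w.r.t. the Euclidean norm) $f:\mathbb R^d\to\mathbb R$ and every $t\ge0$, $\mathbb P_{x\sim\nu}[|f(x)-\mathbb E_\nu f|\ge t]\le 2e^{-dt^2/(2cL^2)}$. Here $\mathrm{Var}(y\mid x)$ refers to the common joint distribution of $(x_i,y_i)$. *)

theory Defs
  imports "HOL-Probability.Probability"
begin

definition isoperimetric :: "real \<Rightarrow> 'a::euclidean_space measure \<Rightarrow> bool" where
  "isoperimetric c \<nu> \<longleftrightarrow>
     (\<forall>(f :: 'a \<Rightarrow> real) L t. L-lipschitz_on UNIV f \<longrightarrow> bounded (range f) \<longrightarrow> t \<ge> 0 \<longrightarrow>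
        measure \<nu> {x \<in> space \<nu>. \<bar>f x - (\<integral>z. f z \<partial>\<nu>)\<bar> \<ge> t}
          \<le> 2 * exp (- (real DIM('a) * t\<^sup>2) / (2 * c * L\<^sup>2)))"

definition exp_cond_var :: "('a::euclidean_space \<times> real) measure \<Rightarrow> real" where
  "exp_cond_var P =
     (\<integral>z. (snd z - real_cond_exp P (vimage_algebra (space P) fst borel) snd z)\<^sup>2 \<partial>P)"

end

theory Submission
  imports Defs
begin

text \<open>
  Clipping to \<open>[-1, 1]\<close> only decreases the loss, so every \<open>f\<close> may be assumed bounded. Let \<open>g\<close> be the
  conditional expectation of \<open>y\<close> given \<open>x\<close> and \<open>z = y - g\<close>. Instead of sampling a latent mixture
  component for each \<open>x\<close>, use the Radon--Nikodym density \<open>p\<^sub>l\<close> of \<open>\<alpha>\<^sub>l \<mu>\<^sub>l\<close> with respect to \<open>\<mu>\<close> as a soft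
  label, and compare \<open>f\<close> with \<open>h = (\<Sum>l. p\<^sub>l * m\<^sub>l)\<close>, where \<open>m\<^sub>l\<close> is the mean of \<open>f\<close> under \<open>\<mu>\<^sub>l\<close>. A small
  empirical loss forces one of the sums of \<open>\<sigma>\<^sup>2 - z\<^sup>2\<close>, \<open>- z g\<close>, \<open>z h\<close>, \<open>z (f - h)\<close> to be of order
  \<open>n \<epsilon>\<close>. The first three are controlled by Hoeffding's inequality. For the last one, \<open>E[z u] = 0\<close>
  for every bounded function \<open>u\<close> of \<open>x\<close>, and by Jensen's inequality the exponential square moment of \<open>f - h\<close>
  under \<open>\<mu>\<close> is at most the \<open>\<alpha>\<close>-average of those of \<open>f - m\<^sub>l\<close> under \<open>\<mu>\<^sub>l\<close>, which isoperimetry bounds.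
\<close>

text \<open>For \<open>x <= 1\<close> combine \<open>exp x <= 1 + x + x^2\<close> with
  \<open>1 + x^2 <= exp (x^2)\<close>; for \<open>x > 1\<close> already \<open>x <= x^2\<close>. The
  linear term is kept apart because it vanishes in expectation for a centred variable, so that only
  an exponential square moment remains.\<close>

lemma exp_le_add_exp_square: "exp x \<le> x + exp (x\<^sup>2)" for x :: real
proof -
  have *: "1 + x\<^sup>2 \<le> exp (x\<^sup>2)" by (rule exp_ge_add_one_self)
  consider "x > 1" | "0 \<le> x" "x \<le> 1" | "x < 0" by linarith
  then show ?thesis
  proof cases
    case 1
    then have "x \<le> x\<^sup>2" by (simp add: power2_eq_square)
    then have "exp x \<le> exp (x\<^sup>2)" by simp
    with 1 show ?thesis by linarith
  next
    case 2
    then have "exp x \<le> 1 + x + x\<^sup>2" by (rule exp_bound)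
    with * show ?thesis by linarith
  next
    case 3
    \<comment> \<open>The positive factor \<open>1 - x\<close> turns the quadratic into
      \<open>1 - x^3\<close>, which is at least 1 for negative \<open>x\<close>, and
      \<open>1 - x\<close> is in turn at most \<open>exp (- x)\<close>.\<close>
    have "(1 + x + x\<^sup>2) * (1 - x) = 1 - x * x\<^sup>2" by (simp add: algebra_simps power2_eq_square)
    also have "\<dots> \<ge> 1" using 3 by (simp add: mult_nonpos_nonneg)
    finally have "1 \<le> (1 + x + x\<^sup>2) * (1 - x)" .
    moreover have "1 - x \<le> exp (- x)" using exp_ge_add_one_self[of "- x"] by simp
    moreover have "0 \<le> 1 + x + x\<^sup>2"
    proof -
      have "1 + x + x\<^sup>2 = (x + 1/2)\<^sup>2 + 3/4" by (simp add: algebra_simps power2_eq_square)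
      then show ?thesis by simp
    qed
    ultimately have "1 \<le> (1 + x + x\<^sup>2) * exp (- x)"
      by (meson mult_left_mono order_trans)
    then have "exp x \<le> 1 + x + x\<^sup>2"
      by (simp add: exp_minus field_simps)
    with * show ?thesis by linarith
  qed
qed

text \<open>Rounds up the constant \<open>e + 2\<close> that summing the tail bound produces:
  \<open>e^2 >= 2 * e >= e + 2\<close> because \<open>e >= 2\<close>.\<close>

lemma exp_2_ge: "exp 1 + 2 \<le> exp (2::real)"
proof -
  have a: "2 \<le> exp (1::real)" using exp_ge_add_one_self[of "1::real"] by simp
  have "exp 1 * 2 \<le> exp 1 * exp (1::real)" using a by simp
  with a have "exp 1 + 2 \<le> exp 1 * exp (1::real)" by linarith
  then show ?thesis by (simp add: mult_exp_exp)
qed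

text \<open>Convexity is what allows Jensen's inequality with the soft labels as weights.\<close>

lemma convex_on_exp_square:
  assumes "\<theta> \<ge> 0"
  shows "convex_on UNIV (\<lambda>x::real. exp (\<theta> * x\<^sup>2))"
proof (rule f''_ge0_imp_convex)
  show "((\<lambda>x. exp (\<theta> * x\<^sup>2)) has_real_derivative 2 * \<theta> * x * exp (\<theta> * x\<^sup>2)) (at x)" for x
    by (auto intro!: derivative_eq_intros)
  show "((\<lambda>x. 2 * \<theta> * x * exp (\<theta> * x\<^sup>2)) has_real_derivative
      (2 * \<theta> + 4 * \<theta>\<^sup>2 * x\<^sup>2) * exp (\<theta> * x\<^sup>2)) (at x)" for x
    by (auto intro!: derivative_eq_intros simp: algebra_simps power2_eq_square)
  show "0 \<le> (2 * \<theta> + 4 * \<theta>\<^sup>2 * x\<^sup>2) * exp (\<theta> * x\<^sup>2)" for x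
    using assms by simp
qed auto

text \<open>A discrete layer-cake bound: the increments over the integers \<open>j <= x\<close>
  telescope to the value of \<open>exp\<close> at the next integer. Taking expectations turns each
  indicator into a tail probability, and a finite \<open>N\<close> keeps this a finite sum.\<close>

lemma exp_le_staircase:
  assumes "0 \<le> x" "x \<le> real N"
  shows "exp x \<le> exp 1 + (\<Sum>j\<in>{1..N}. (exp (real j + 1) - exp (real j)) * of_bool (real j \<le> x))"
  using assms(2)
proof (induction N)
  case 0
  then show ?case using assms(1) by auto
next
  case (Suc N)
  define f where "f = (\<lambda>j. (exp (real j + 1) - exp (real j)) * of_bool (real j \<le> x))"
  have f: "0 \<le> f (Suc N)" by (auto simp: f_def)
  have "exp x \<le> exp 1 + sum f {1..Suc N}"
  proof (cases "x \<le> real N")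
    case True
    have "exp x \<le> exp 1 + sum f {1..N}" unfolding f_def by (rule Suc.IH[OF True])
    with f show ?thesis by simp
  next
    case False
    have "sum f {1..N} = (\<Sum>j\<in>{1..N}. exp (real (Suc j)) - exp (real j))"
      unfolding f_def using False by (intro sum.cong) (auto simp: algebra_simps)
    also have "\<dots> = exp (real (Suc N)) - exp 1"
      by (induction N) auto
    finally have "sum f {1..N} = exp (real (Suc N)) - exp 1" .
    moreover have "exp x \<le> exp (real (Suc N))" using Suc.prems by (simp only: exp_le_cancel_iff)
    moreover have "sum f {1..Suc N} = sum f {1..N} + f (Suc N)" by simp
    ultimately show ?thesis using f by linarith
  qed
  then show ?case by (simp only: f_def)
qed

text \<open>A geometric series with ratio \<open>1 / e\<close>: multiplied by \<open>e - 1\<close>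
  it telescopes. The bound is uniform in \<open>N\<close>.\<close>

lemma sum_exp_minus_le: "(\<Sum>j\<in>{1..N}. exp (- real j)) \<le> 1 / (exp 1 - 1)"
proof -
  have e: "exp (1::real) > 1" by simp
  have "(\<Sum>j\<in>{1..N}. exp (- real j)) * (exp 1 - 1) = 1 - exp (- real N)"
    by (induction N) (auto simp: algebra_simps simp flip: exp_add)
  also have "\<dots> \<le> 1" by simp
  finally show ?thesis using e by (simp add: field_simps)
qed

text \<open>Integrating the staircase weights the tail \<open>2 * exp (- 2 * j)\<close> by the
  increment \<open>(e - 1) * exp j\<close>, which leaves a geometric series of total at most 2. The
  bound \<open>B\<close> fixes the number of steps, while the result is uniform in it.\<close>

lemma (in prob_space) expectation_exp_le_of_tail:
  assumes [measurable]: "X \<in> borel_measurable M"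
    and X: "\<And>x. 0 \<le> X x" "\<And>x. X x \<le> B"
    and tail: "\<And>t. 0 \<le> t \<Longrightarrow> prob {x \<in> space M. t \<le> X x} \<le> 2 * exp (- 2 * t)"
  shows "(\<integral>\<^sup>+x. exp (X x) \<partial>M) \<le> ennreal (exp 2)"
proof -
  obtain N where N: "B \<le> real N" using real_arch_simple by blast
  define S where "S = (\<lambda>x. exp 1 + (\<Sum>j\<in>{1..N}. (exp (real j + 1) - exp (real j)) *
    indicat_real {x \<in> space M. real j \<le> X x} x))"
  have [simp]: "integrable M (indicat_real {x \<in> space M. real j \<le> X x})" for j :: nat
    by (rule integrable_real_indicator) (auto simp: less_top[symmetric])
  have int: "integrable M S" unfolding S_def
    by (intro Bochner_Integration.integrable_add Bochner_Integration.integrable_sum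
        integrable_mult_right integrable_const) simp
  have "(\<integral>\<^sup>+x. exp (X x) \<partial>M) \<le> (\<integral>\<^sup>+x. ennreal (S x) \<partial>M)"
  proof (intro nn_integral_mono ennreal_leI)
    fix x assume x: "x \<in> space M"
    have "indicat_real {x \<in> space M. real j \<le> X x} x = of_bool (real j \<le> X x)" for j :: nat
      using x by (auto simp: indicator_def)
    then show "exp (X x) \<le> S x"
      unfolding S_def using exp_le_staircase[of "X x" N] X[of x] N by simp
  qed
  also have "\<dots> = ennreal (expectation S)"
    by (intro nn_integral_eq_integral int) (auto simp: S_def intro!: add_nonneg_nonneg sum_nonneg)
  also have "expectation S = exp 1 + (\<Sum>j\<in>{1..N}. (exp (real j + 1) - exp (real j)) *
      prob {x \<in> space M. real j \<le> X x})"
    unfolding S_def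
    by (subst Bochner_Integration.integral_add, simp, intro Bochner_Integration.integrable_sum
        integrable_mult_right, simp, subst Bochner_Integration.integral_sum)
       (auto simp: prob_space simp del: sum_mult_indicator intro!: integrable_mult_right sum.cong)
  also have "\<dots> \<le> exp 1 + (\<Sum>j\<in>{1..N}. (exp (real j + 1) - exp (real j)) * (2 * exp (- 2 * real j)))"
    by (intro add_left_mono sum_mono mult_left_mono tail) auto
  also have "(\<Sum>j\<in>{1..N}. (exp (real j + 1) - exp (real j)) * (2 * exp (- 2 * real j))) =
      2 * (exp 1 - 1) * (\<Sum>j\<in>{1..N}. exp (- real j))"
    unfolding sum_distrib_left
    by (intro sum.cong) (auto simp: algebra_simps simp flip: exp_add)
  also have "\<dots> \<le> 2 * (exp 1 - 1) * (1 / (exp 1 - 1))"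
    by (intro mult_left_mono sum_exp_minus_le) auto
  also have "\<dots> = 2" by (subst mult.assoc) simp
  finally show ?thesis using exp_2_ge by (meson add_left_mono ennreal_leI order_trans)
qed

text \<open>Markov's inequality for the exponential of the sum, whose moment factorises over the
  product measure. The exponent per sample, \<open>K * l^2 - l * t\<close>, is minimal at
  \<open>l = t / (2 * K)\<close>.\<close>

lemma (in prob_space) chernoff_PiM:
  fixes v :: "'a \<Rightarrow> real"
  assumes [measurable]: "v \<in> borel_measurable M"
    and mgf: "\<And>l. l > 0 \<Longrightarrow> (\<integral>\<^sup>+x. exp (l * v x) \<partial>M) \<le> ennreal (exp (K * l\<^sup>2))"
    and K: "K > 0" and t: "t > 0"
  shows "measure (PiM {..<n} (\<lambda>_. M)) {\<omega> \<in> space (PiM {..<n} (\<lambda>_. M)). (\<Sum>i<n. v (\<omega> i)) \<ge> real n * t}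
    \<le> exp (- (real n * t\<^sup>2 / (4 * K)))"
proof -
  define l where "l = t / (2 * K)"
  have l: "l > 0" using K t by (simp add: l_def)
  let ?P = "PiM {..<n} (\<lambda>_. M)"
  interpret P: prob_space ?P by (intro prob_space_PiM prob_space_axioms)
  interpret product_sigma_finite "\<lambda>_::nat. M" by standard
  let ?A = "{\<omega> \<in> space ?P. (\<Sum>i<n. v (\<omega> i)) \<ge> real n * t}"
  have "ennreal (measure ?P ?A) = emeasure ?P ?A" by (simp add: P.emeasure_eq_measure)
  also have "\<dots> \<le> ennreal (exp (- l * (real n * t))) *
      (\<integral>\<^sup>+\<omega>\<in>space ?P. exp (l * (\<Sum>i<n. v (\<omega> i))) \<partial>?P)"
    by (intro Chernoff_ineq_nn_integral_ge l) auto
  also have "(\<integral>\<^sup>+\<omega>\<in>space ?P. exp (l * (\<Sum>i<n. v (\<omega> i))) \<partial>?P) =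
      (\<integral>\<^sup>+\<omega>. (\<Prod>i<n. ennreal (exp (l * v (\<omega> i)))) \<partial>?P)"
    by (intro nn_integral_cong) (simp_all add: sum_distrib_left exp_sum prod_ennreal)
  also have "\<dots> = (\<Prod>i<n. \<integral>\<^sup>+x. ennreal (exp (l * v x)) \<partial>M)"
    by (intro product_nn_integral_prod) auto
  also have "\<dots> \<le> (\<Prod>i<n. ennreal (exp (K * l\<^sup>2)))"
    by (intro prod_mono_ennreal mgf l)
  also have "ennreal (exp (- l * (real n * t))) * \<dots> = ennreal (exp (real n * (K * l\<^sup>2) - l * (real n * t)))"
    by (simp add: prod_ennreal exp_diff exp_minus divide_simps exp_of_nat_mult ennreal_power flip: ennreal_mult)
  also have "real n * (K * l\<^sup>2) - l * (real n * t) = - (real n * t\<^sup>2 / (4 * K))"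
    using K by (simp add: l_def field_simps power2_eq_square)
  finally show ?thesis by (simp add: mult_left_mono)
qed

text \<open>Hoeffding's lemma supplies the Chernoff bound with \<open>K = d^2 / 8\<close>.\<close>

lemma (in prob_space) hoeffding_PiM:
  assumes [measurable]: "v \<in> borel_measurable M"
    and bnd: "AE x in M. v x \<in> {a..b}" and ab: "b - a = d" "d > 0"
    and E: "expectation v = 0" and t: "t > 0"
  shows "measure (PiM {..<n} (\<lambda>_. M)) {\<omega> \<in> space (PiM {..<n} (\<lambda>_. M)). (\<Sum>i<n. v (\<omega> i)) \<ge> real n * t}
    \<le> exp (- (2 * real n * t\<^sup>2 / d\<^sup>2))"
proof -
  interpret interval_bounded_random_variable M v a b
    by standard (use bnd in auto)
  have "(\<integral>\<^sup>+x. exp (l * v x) \<partial>M) \<le> ennreal (exp (d\<^sup>2 / 8 * l\<^sup>2))" if "l > 0" for l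
    using Hoeffdings_lemma_nn_integral_0[OF that E] by (simp add: ab mult.commute)
  from chernoff_PiM[OF assms(1) this, where t=t and n=n] t ab show ?thesis by (simp add: mult_ac)
qed

text \<open>The product of a bounded factor \<open>z\<close> and a subgaussian factor \<open>u\<close> is subgaussian once it is
  centred: for small \<open>l\<close> this uses \<open>exp x \<le> x + exp (x\<^sup>2)\<close>, for large \<open>l\<close> AM-GM.\<close>
lemma (in prob_space) mgf_mult_subgaussian:
  fixes u z :: "'a \<Rightarrow> real"
  assumes [measurable]: "u \<in> borel_measurable M" "z \<in> borel_measurable M"
    and z: "AE x in M. \<bar>z x\<bar> \<le> 2" and u: "AE x in M. \<bar>u x\<bar> \<le> C"
    and E: "expectation (\<lambda>x. z x * u x) = 0"
    and s: "s > 0" and sub: "(\<integral>\<^sup>+x. exp ((u x)\<^sup>2 / (4 * s)) \<partial>M) \<le> ennreal (exp 2)"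
    and l: "l > 0"
  shows "(\<integral>\<^sup>+x. exp (l * (z x * u x)) \<partial>M) \<le> ennreal (exp (36 * s * l\<^sup>2))"
proof (cases "16 * (l\<^sup>2 * s) \<le> 1")
  case True
  \<comment> \<open>Chosen so that \<open>4 * l^2 * u^2\<close> is \<open>a\<close> times the
    exponent \<open>u^2 / (4 * s)\<close> of the hypothesis. For \<open>a <= 1\<close> the moment
    bound \<open>exp 2\<close> can then be raised to the power \<open>a\<close>.\<close>
  define a where "a = 16 * (l\<^sup>2 * s)"
  have a: "0 \<le> a" "a \<le> 1" using True s by (auto simp: a_def)
  have C: "AE x in M. (u x)\<^sup>2 \<le> C\<^sup>2" using u by eventually_elim (metis abs_ge_zero power2_abs power_mono)
  have int: "integrable M (\<lambda>x. exp (4 * l\<^sup>2 * (u x)\<^sup>2))"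
    by (rule integrable_const_bound[where B="exp (4 * l\<^sup>2 * C\<^sup>2)"])
       (use C in \<open>eventually_elim; auto intro!: mult_left_mono\<close>, simp)
  have int2: "integrable M (\<lambda>x. exp ((u x)\<^sup>2 / (4 * s)))"
    by (rule integrable_const_bound[where B="exp (C\<^sup>2 / (4 * s))"])
       (use C in \<open>eventually_elim; use s in \<open>auto intro!: divide_right_mono\<close>\<close>, simp)
  have int3: "integrable M (\<lambda>x. l * (z x * u x))"
    by (rule integrable_const_bound[where B="l * (2 * C)"])
       (use z u in \<open>eventually_elim; use l in \<open>auto simp: abs_mult intro!: mult_mono mult_left_mono\<close>\<close>, simp)
  have sub': "expectation (\<lambda>x. exp ((u x)\<^sup>2 / (4 * s))) \<le> exp 2"
    using sub by (subst (asm) nn_integral_eq_integral[OF int2]) auto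
  have le: "AE x in M. exp (l * (z x * u x)) \<le> l * (z x * u x) + exp (4 * l\<^sup>2 * (u x)\<^sup>2)"
  proof (use z in eventually_elim)
    fix x assume zx: "\<bar>z x\<bar> \<le> 2"
    have "exp (l * (z x * u x)) \<le> l * (z x * u x) + exp ((l * (z x * u x))\<^sup>2)"
      by (rule exp_le_add_exp_square)
    also have "(l * (z x * u x))\<^sup>2 = (z x)\<^sup>2 * (l\<^sup>2 * (u x)\<^sup>2)" by (simp add: power_mult_distrib)
    also have "\<dots> \<le> 4 * (l\<^sup>2 * (u x)\<^sup>2)"
      using power_mono[OF zx, of 2] by (intro mult_right_mono) auto
    finally show "exp (l * (z x * u x)) \<le> l * (z x * u x) + exp (4 * l\<^sup>2 * (u x)\<^sup>2)"
      by (simp add: mult.assoc)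
  qed
  then have "(\<integral>\<^sup>+x. exp (l * (z x * u x)) \<partial>M) \<le>
      (\<integral>\<^sup>+x. ennreal (l * (z x * u x) + exp (4 * l\<^sup>2 * (u x)\<^sup>2)) \<partial>M)"
    by (intro nn_integral_mono_AE) (auto elim!: eventually_mono intro!: ennreal_leI)
  also have "\<dots> = ennreal (expectation (\<lambda>x. l * (z x * u x) + exp (4 * l\<^sup>2 * (u x)\<^sup>2)))"
    by (intro nn_integral_eq_integral Bochner_Integration.integrable_add int int3)
       (auto intro: eventually_mono[OF le] order_trans[OF exp_ge_zero])
  also have "expectation (\<lambda>x. l * (z x * u x) + exp (4 * l\<^sup>2 * (u x)\<^sup>2)) =
      expectation (\<lambda>x. exp (4 * l\<^sup>2 * (u x)\<^sup>2))"
    using E by (subst Bochner_Integration.integral_add[OF int3 int]) simp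
  also have "\<dots> \<le> expectation (\<lambda>x. exp (2 * a) * ((1 - a) + a * (exp (- 2) * exp ((u x)\<^sup>2 / (4 * s)))))"
  proof (intro integral_mono int)
    show "integrable M (\<lambda>x. exp (2 * a) * ((1 - a) + a * (exp (- 2) * exp ((u x)\<^sup>2 / (4 * s)))))"
      by (intro integrable_mult_right Bochner_Integration.integrable_add int2) auto
    fix x
    \<comment> \<open>The shift by 2 normalises the moment: the expectation of \<open>exp w\<close>
      is at most 1, so the convexity bound between 0 and \<open>w\<close> integrates to at most 1.
      This is Jensen's inequality for the power \<open>a\<close>, done pointwise.\<close>
    define w where "w = (u x)\<^sup>2 / (4 * s) - 2"
    have "exp ((1 - a) *\<^sub>R 0 + a *\<^sub>R w) \<le> (1 - a) * exp 0 + a * exp w"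
      by (rule convex_onD[OF exp_convex]) (use a in auto)
    then have "exp (a * w) \<le> (1 - a) + a * exp w" by simp
    then have "exp (2 * a) * exp (a * w) \<le> exp (2 * a) * ((1 - a) + a * exp w)" by simp
    moreover have "4 * l\<^sup>2 * (u x)\<^sup>2 = 2 * a + a * w"
      using s by (simp add: a_def w_def field_simps)
    ultimately show "exp (4 * l\<^sup>2 * (u x)\<^sup>2) \<le> exp (2 * a) * ((1 - a) + a * (exp (- 2) * exp ((u x)\<^sup>2 / (4 * s))))"
      by (simp add: w_def exp_add exp_diff exp_minus field_simps)
  qed
  also have "\<dots> = exp (2 * a) * ((1 - a) + a * (exp (- 2) * expectation (\<lambda>x. exp ((u x)\<^sup>2 / (4 * s)))))"
    using int2 by (simp add: prob_space)
  also have "\<dots> \<le> exp (2 * a) * ((1 - a) + a * (exp (- 2) * exp 2))"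
    using a sub' by (intro mult_left_mono add_left_mono) auto
  also have "\<dots> = exp (2 * a)" by (simp flip: exp_add)
  also have "\<dots> \<le> exp (36 * s * l\<^sup>2)" using s by (simp add: a_def)
  finally show ?thesis by (simp add: ennreal_leI)
next
  case False
  have "(\<integral>\<^sup>+x. exp (l * (z x * u x)) \<partial>M) \<le>
      (\<integral>\<^sup>+x. ennreal (exp (4 * s * l\<^sup>2)) * ennreal (exp ((u x)\<^sup>2 / (4 * s))) \<partial>M)"
  proof (intro nn_integral_mono_AE, use z in eventually_elim)
    fix x assume zx: "\<bar>z x\<bar> \<le> 2"
    have "l * (z x * u x) \<le> \<bar>l * (z x * u x)\<bar>" by simp
    also have "\<dots> \<le> 2 * l * \<bar>u x\<bar>"
      using mult_right_mono[OF zx, of "l * \<bar>u x\<bar>"] l by (simp add: abs_mult mult_ac)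
    also have "\<dots> \<le> 4 * s * l\<^sup>2 + (u x)\<^sup>2 / (4 * s)"
    proof -
      \<comment> \<open>AM-GM with weights matched to the exponent \<open>u^2 / (4 * s)\<close> that
        the hypothesis controls.\<close>
      have "0 \<le> (4 * s * l - \<bar>u x\<bar>)\<^sup>2 / (4 * s)" using s by simp
      also have "\<dots> = 4 * s * l\<^sup>2 + (u x)\<^sup>2 / (4 * s) - 2 * l * \<bar>u x\<bar>"
        using s by (simp add: power2_diff field_simps) (simp add: power2_eq_square)
      finally show ?thesis by simp
    qed
    finally show "ennreal (exp (l * (z x * u x))) \<le>
        ennreal (exp (4 * s * l\<^sup>2)) * ennreal (exp ((u x)\<^sup>2 / (4 * s)))"
      by (simp flip: ennreal_mult exp_add)
  qed
  also have "\<dots> = ennreal (exp (4 * s * l\<^sup>2)) * (\<integral>\<^sup>+x. exp ((u x)\<^sup>2 / (4 * s)) \<partial>M)"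
    by (rule nn_integral_cmult) simp
  also have "\<dots> \<le> ennreal (exp (4 * s * l\<^sup>2)) * ennreal (exp 2)"
    by (intro mult_left_mono sub) simp
  also have "\<dots> = ennreal (exp (4 * s * l\<^sup>2 + 2))" by (simp add: exp_add flip: ennreal_mult)
  \<comment> \<open>For large \<open>l\<close> the additive 2 is below \<open>32 * s * l^2\<close>,
    and \<open>4 + 32\<close> is the source of the 36; the other case needs only 32.\<close>
  also have "\<dots> \<le> ennreal (exp (36 * s * l\<^sup>2))"
    using False by (intro ennreal_leI) (simp add: algebra_simps)
  finally show ?thesis .
qed

text \<open>The function \<open>p l\<close> is the posterior weight of component \<open>l\<close> at
  \<open>x\<close>, the density of \<alpha> \<open>l\<close> times \<mu>s \<open>l\<close> relative
  to \<mu>. It exists because a \<mu>-null set is null for each nonnegative summand of the mixture,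
  and the weights sum to 1 by uniqueness of the density of \<mu> with respect to itself.\<close>

lemma mixture_weights:
  fixes \<mu> :: "'a measure" and \<mu>s :: "nat \<Rightarrow> 'a measure" and \<alpha> :: "nat \<Rightarrow> real"
  assumes "prob_space \<mu>"
    and prob: "\<And>l. l < k \<Longrightarrow> prob_space (\<mu>s l)"
    and sets: "\<And>l. l < k \<Longrightarrow> sets (\<mu>s l) = sets \<mu>"
    and \<alpha>: "\<And>l. l < k \<Longrightarrow> \<alpha> l \<ge> 0"
    and mix: "\<And>A. A \<in> sets \<mu> \<Longrightarrow> measure \<mu> A = (\<Sum>l<k. \<alpha> l * measure (\<mu>s l) A)"
  obtains p :: "nat \<Rightarrow> 'a \<Rightarrow> real" where
    "\<And>l. p l \<in> borel_measurable \<mu>" "\<And>l x. 0 \<le> p l x" "AE x in \<mu>. (\<Sum>l<k. p l x) = 1"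
    "\<And>l \<phi>. l < k \<Longrightarrow> \<phi> \<in> borel_measurable \<mu> \<Longrightarrow>
       (\<integral>\<^sup>+x. ennreal (p l x) * \<phi> x \<partial>\<mu>) = ennreal (\<alpha> l) * (\<integral>\<^sup>+x. \<phi> x \<partial>\<mu>s l)"
proof -
  interpret prob_space \<mu> by fact
  have em: "emeasure (\<mu>s l) A = ennreal (measure (\<mu>s l) A)" if "l < k" for l A
  proof -
    interpret l: prob_space "\<mu>s l" by (rule prob[OF that])
    show ?thesis by (rule l.emeasure_eq_measure)
  qed
  define N where "N = (\<lambda>l. density (\<mu>s l) (\<lambda>_. ennreal (\<alpha> l)))"
  have setsN: "sets (N l) = sets \<mu>" if "l < k" for l using sets[OF that] by (simp add: N_def)
  have N: "emeasure (N l) A = ennreal (\<alpha> l * measure (\<mu>s l) A)" if "l < k" "A \<in> sets \<mu>" for l A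
    using that sets[OF that(1)] \<alpha> by (simp add: N_def emeasure_density_const em ennreal_mult)
  have nnN: "(\<integral>\<^sup>+x. \<phi> x \<partial>N l) = ennreal (\<alpha> l) * (\<integral>\<^sup>+x. \<phi> x \<partial>\<mu>s l)"
    if "l < k" "\<phi> \<in> borel_measurable \<mu>" for l \<phi>
  proof -
    have [measurable]: "\<phi> \<in> borel_measurable (\<mu>s l)"
      using that sets[OF that(1)] by (simp cong: measurable_cong_sets)
    show ?thesis by (simp add: N_def nn_integral_density nn_integral_cmult)
  qed
  have ac: "absolutely_continuous \<mu> (N l)" if l: "l < k" for l
  proof -
    have "A \<in> null_sets (N l)" if A: "A \<in> null_sets \<mu>" for A
    proof -
      have A': "A \<in> sets \<mu>" "measure \<mu> A = 0" using A by (auto simp: measure_eq_0_null_sets)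
      then have "(\<Sum>l<k. \<alpha> l * measure (\<mu>s l) A) = 0" using mix by simp
      then have "\<alpha> l * measure (\<mu>s l) A = 0"
        using l \<alpha> by (subst (asm) sum_nonneg_eq_0_iff) auto
      then show ?thesis using N[OF l A'(1)] A' l setsN by (intro null_setsI) auto
    qed
    then show ?thesis by (auto simp: absolutely_continuous_def)
  qed
  define r where "r = (\<lambda>l. RN_deriv \<mu> (N l))"
  have [measurable]: "r l \<in> borel_measurable \<mu>" for l by (simp add: r_def)
  have r: "(\<integral>\<^sup>+x. r l x * \<phi> x \<partial>\<mu>) = ennreal (\<alpha> l) * (\<integral>\<^sup>+x. \<phi> x \<partial>\<mu>s l)"
    if "l < k" "\<phi> \<in> borel_measurable \<mu>" for l \<phi>
    using RN_deriv_nn_integral[OF ac[OF that(1)] setsN[OF that(1)] that(2)] nnN[OF that]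
    by (simp add: r_def)
  have sum_r: "AE x in \<mu>. (\<Sum>l<k. r l x) = 1"
  proof (rule density_unique_finite_measure)
    fix A assume A: "A \<in> sets \<mu>"
    have "(\<integral>\<^sup>+x. (\<Sum>l<k. r l x) * indicator A x \<partial>\<mu>) = (\<Sum>l<k. \<integral>\<^sup>+x. r l x * indicator A x \<partial>\<mu>)"
      unfolding sum_distrib_right using A by (intro nn_integral_sum) auto
    also have "\<dots> = (\<Sum>l<k. ennreal (\<alpha> l * measure (\<mu>s l) A))"
      using A sets \<alpha> by (intro sum.cong) (auto simp: r em ennreal_mult)
    also have "\<dots> = ennreal (measure \<mu> A)"
      using \<alpha> by (subst sum_ennreal) (auto simp: mix[OF A])
    also have "\<dots> = (\<integral>\<^sup>+x. 1 * indicator A x \<partial>\<mu>)"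
      using A by (simp add: emeasure_eq_measure)
    finally show "(\<integral>\<^sup>+x. (\<Sum>l<k. r l x) * indicator A x \<partial>\<mu>) = (\<integral>\<^sup>+x. 1 * indicator A x \<partial>\<mu>)" .
  qed auto
  \<comment> \<open>Nonnegative extended reals with sum 1 are each at most 1, so passing to real
    values changes them only on a null set.\<close>
  have fin: "AE x in \<mu>. \<forall>l<k. ennreal (enn2real (r l x)) = r l x"
    using sum_r
  proof eventually_elim
    case (elim x)
    have "r l x \<le> 1" if "l < k" for l
      unfolding elim[symmetric] using that by (intro member_le_sum) auto
    then show ?case by (meson ennreal_enn2real ennreal_one_less_top le_less_trans)
  qed
  show thesis
  proof (rule that[of "\<lambda>l x. enn2real (r l x)"])
    show "AE x in \<mu>. (\<Sum>l<k. enn2real (r l x)) = 1"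
      using sum_r fin
    proof eventually_elim
      case (elim x)
      have "ennreal (\<Sum>l<k. enn2real (r l x)) = (\<Sum>l<k. ennreal (enn2real (r l x)))"
        by (rule sum_ennreal[symmetric]) simp
      also have "\<dots> = ennreal 1" using elim by simp
      finally show ?case by (subst (asm) ennreal_inj) (auto intro: sum_nonneg)
    qed
    show "(\<integral>\<^sup>+x. ennreal (enn2real (r l x)) * \<phi> x \<partial>\<mu>) = ennreal (\<alpha> l) * (\<integral>\<^sup>+x. \<phi> x \<partial>\<mu>s l)"
      if "l < k" "\<phi> \<in> borel_measurable \<mu>" for l \<phi>
      unfolding r[OF that, symmetric]
      by (intro nn_integral_cong_AE) (use that in \<open>auto intro: eventually_mono[OF fin]\<close>)
  qed auto
qed

text \<open>The number \<open>s\<close> is the variance proxy from isoperimetry. At radius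
  \<open>2 * sqrt (s * t)\<close> the isoperimetric tail is exactly
  \<open>2 * exp (- 2 * t)\<close>, the tail required for the exponential moment of the scaled
  square.\<close>

lemma isoperimetric_exp_square_moment:
  fixes \<nu> :: "'a::euclidean_space measure" and f :: "'a \<Rightarrow> real"
  assumes "prob_space \<nu>" and sets: "sets \<nu> = sets borel" and iso: "isoperimetric c \<nu>"
    and lip: "L-lipschitz_on UNIV f" and bnd: "\<And>x. \<bar>f x\<bar> \<le> 1"
    and c: "c > 0" and L: "L > 0" and s: "s = c * L\<^sup>2 / real DIM('a)"
  shows "(\<integral>\<^sup>+x. exp (1 / (4 * s) * (f x - (\<integral>z. f z \<partial>\<nu>))\<^sup>2) \<partial>\<nu>) \<le> ennreal (exp 2)"
proof -
  interpret prob_space \<nu> by fact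
  have s0: "s > 0" using c L by (simp add: s)
  have "f \<in> borel_measurable borel"
    using lipschitz_on_continuous_on[OF lip] by (rule borel_measurable_continuous_onI)
  then have [measurable]: "f \<in> borel_measurable \<nu>" by (simp add: sets cong: measurable_cong_sets)
  let ?m = "\<integral>z. f z \<partial>\<nu>"
  have m: "\<bar>f x - ?m\<bar> \<le> 1 + \<bar>?m\<bar>" for x
    using bnd[of x] by linarith
  show ?thesis
  proof (rule expectation_exp_le_of_tail)
    show "1 / (4 * s) * (f x - ?m)\<^sup>2 \<le> 1 / (4 * s) * (1 + \<bar>?m\<bar>)\<^sup>2" for x
      using power_mono[OF m[of x], of 2] s0 by (intro mult_left_mono) auto
    fix t :: real assume t: "0 \<le> t"
    have "bounded (range f)" using bnd by (auto simp: bounded_iff)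
    then have "prob {x \<in> space \<nu>. \<bar>f x - ?m\<bar> \<ge> 2 * sqrt (s * t)}
        \<le> 2 * exp (- (real DIM('a) * (2 * sqrt (s * t))\<^sup>2) / (2 * c * L\<^sup>2))"
      using iso[unfolded isoperimetric_def, rule_format, OF lip, of "2 * sqrt (s * t)"] t s0
      by simp
    also have "- (real DIM('a) * (2 * sqrt (s * t))\<^sup>2) / (2 * c * L\<^sup>2) = - 2 * t"
      using t s0 c L by (simp add: s field_simps power_mult_distrib)
    also have "{x \<in> space \<nu>. \<bar>f x - ?m\<bar> \<ge> 2 * sqrt (s * t)} =
        {x \<in> space \<nu>. t \<le> 1 / (4 * s) * (f x - ?m)\<^sup>2}"
    proof -
      have "2 * sqrt (s * t) \<le> \<bar>a\<bar> \<longleftrightarrow> t \<le> 1 / (4 * s) * a\<^sup>2" for a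
      proof -
        have "2 * sqrt (s * t) = sqrt (4 * s * t)" by (simp add: real_sqrt_mult)
        moreover have "\<bar>a\<bar> = sqrt (a\<^sup>2)" by simp
        ultimately have "2 * sqrt (s * t) \<le> \<bar>a\<bar> \<longleftrightarrow> 4 * s * t \<le> a\<^sup>2"
          by (metis real_sqrt_le_iff)
        then show ?thesis using s0 by (simp add: field_simps)
      qed
      then show ?thesis by simp
    qed
    finally show "prob {x \<in> space \<nu>. t \<le> 1 / (4 * s) * (f x - ?m)\<^sup>2} \<le> 2 * exp (- 2 * t)" .
  qed (use s0 in auto)
qed

text \<open>Since the weights sum to 1, \<open>f\<close> minus the combined mean is the
  \<open>p\<close>-average of the deviations of \<open>f\<close> from its component means. Jensen's
  inequality moves the average outside, and integrating \<open>p l\<close> against \<mu> gives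
  \<alpha> \<open>l\<close> times an integral over component \<open>l\<close>. As \<alpha> sums to
  1, the constant does not grow with \<open>k\<close>.\<close>

lemma mixture_exp_square_moment:
  fixes \<mu> :: "'a::euclidean_space measure" and f :: "'a \<Rightarrow> real" and p :: "nat \<Rightarrow> 'a \<Rightarrow> real"
  assumes [measurable_cong]: "sets \<mu> = sets borel"
    and p [measurable]: "\<And>l. p l \<in> borel_measurable \<mu>" and p0: "\<And>l x. 0 \<le> p l x"
    and p1: "AE x in \<mu>. (\<Sum>l<k. p l x) = 1"
    and p_int: "\<And>l \<phi>. l < k \<Longrightarrow> \<phi> \<in> borel_measurable \<mu> \<Longrightarrow>
       (\<integral>\<^sup>+x. ennreal (p l x) * \<phi> x \<partial>\<mu>) = ennreal (\<alpha> l) * (\<integral>\<^sup>+x. \<phi> x \<partial>\<mu>s l)"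
    and prob: "\<And>l. l < k \<Longrightarrow> prob_space (\<mu>s l)"
    and sets: "\<And>l. l < k \<Longrightarrow> sets (\<mu>s l) = sets borel"
    and iso: "\<And>l. l < k \<Longrightarrow> isoperimetric c (\<mu>s l)"
    and \<alpha>: "\<And>l. l < k \<Longrightarrow> \<alpha> l \<ge> 0" "(\<Sum>l<k. \<alpha> l) = 1"
    and lip: "L-lipschitz_on UNIV f" and bnd: "\<And>x. \<bar>f x\<bar> \<le> 1"
    and c: "c > 0" and L: "L > 0" and s: "s = c * L\<^sup>2 / real DIM('a)"
  shows "(\<integral>\<^sup>+x. exp ((f x - (\<Sum>l<k. (\<integral>z. f z \<partial>\<mu>s l) * p l x))\<^sup>2 / (4 * s)) \<partial>\<mu>) \<le> ennreal (exp 2)"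
proof -
  have s0: "s > 0" using c L by (simp add: s)
  have [measurable]: "f \<in> borel_measurable borel"
    using lipschitz_on_continuous_on[OF lip] by (rule borel_measurable_continuous_onI)
  define m where "m = (\<lambda>l. \<integral>z. f z \<partial>\<mu>s l)"
  have k: "{..<k} \<noteq> {}" using \<alpha>(2) by (metis sum.empty zero_neq_one)
  have "(\<integral>\<^sup>+x. exp ((f x - (\<Sum>l<k. m l * p l x))\<^sup>2 / (4 * s)) \<partial>\<mu>)
      \<le> (\<integral>\<^sup>+x. (\<Sum>l<k. ennreal (p l x) * ennreal (exp (1 / (4 * s) * (f x - m l)\<^sup>2))) \<partial>\<mu>)"
  proof (intro nn_integral_mono_AE, use p1 in eventually_elim)
    fix x assume x: "(\<Sum>l<k. p l x) = 1"
    have "exp (1 / (4 * s) * (\<Sum>l<k. p l x *\<^sub>R (f x - m l))\<^sup>2)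
        \<le> (\<Sum>l<k. p l x * exp (1 / (4 * s) * (f x - m l)\<^sup>2))"
      by (rule convex_on_sum[OF finite_lessThan k convex_on_exp_square x]) (use s0 p0 in auto)
    also have "(\<Sum>l<k. p l x *\<^sub>R (f x - m l)) = f x - (\<Sum>l<k. m l * p l x)"
      using x by (simp add: right_diff_distrib sum_subtractf mult.commute[of "p _ x"] flip: sum_distrib_left)
    finally have "exp ((f x - (\<Sum>l<k. m l * p l x))\<^sup>2 / (4 * s))
        \<le> (\<Sum>l<k. p l x * exp (1 / (4 * s) * (f x - m l)\<^sup>2))" by simp
    also have "ennreal \<dots> = (\<Sum>l<k. ennreal (p l x) * ennreal (exp (1 / (4 * s) * (f x - m l)\<^sup>2)))"
      using p0 by (subst sum_ennreal[symmetric]) (auto simp: ennreal_mult)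
    finally show "ennreal (exp ((f x - (\<Sum>l<k. m l * p l x))\<^sup>2 / (4 * s))) \<le> \<dots>"
      by (simp add: ennreal_leI)
  qed
  also have "\<dots> = (\<Sum>l<k. \<integral>\<^sup>+x. ennreal (p l x) * ennreal (exp (1 / (4 * s) * (f x - m l)\<^sup>2)) \<partial>\<mu>)"
    by (intro nn_integral_sum) auto
  also have "\<dots> = (\<Sum>l<k. ennreal (\<alpha> l) * (\<integral>\<^sup>+x. exp (1 / (4 * s) * (f x - m l)\<^sup>2) \<partial>\<mu>s l))"
    by (intro sum.cong p_int) auto
  also have "\<dots> \<le> (\<Sum>l<k. ennreal (\<alpha> l) * ennreal (exp 2))"
    unfolding m_def
    by (intro sum_mono mult_left_mono
          isoperimetric_exp_square_moment[OF prob sets iso lip bnd c L s]) auto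
  also have "\<dots> = ennreal (exp 2)"
  proof -
    have "(\<Sum>l<k. ennreal (\<alpha> l)) = 1" using \<alpha> by (subst sum_ennreal) auto
    then show ?thesis by (simp flip: sum_distrib_right)
  qed
  finally show ?thesis by (simp only: m_def)
qed

text \<open>With \<open>w = exp (- v / k)\<close> the left side is \<open>(2 * w)^k\<close>. The
  second assumption, the regime in which the final bound is nontrivial, forces
  \<open>2 * w <= 1\<close>, so the power is at most \<open>2 * w\<close>.\<close>

lemma sign_union_bound:
  fixes v :: real
  assumes "k \<ge> 1" and "4 * real k * exp (- v / real k) \<le> 1"
  shows "2 ^ k * exp (- v) \<le> 2 * real k * exp (- v / real k)"
proof -
  define w where "w = exp (- v / real k)"
  have w: "w > 0" by (simp add: w_def)
  have "2 * w \<le> 4 * real k * w" using assms(1) w by (intro mult_right_mono) auto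
  then have w1: "2 * w \<le> 1" using assms(2) by (simp only: w_def)
  have "exp (- v) = w ^ k" using assms(1) by (simp add: w_def flip: exp_of_nat_mult)
  then have "2 ^ k * exp (- v) = (2 * w) ^ k" by (simp add: power_mult_distrib)
  also have "\<dots> = 2 * w * (2 * w) ^ (k - 1)" using assms(1) by (cases k) auto
  also have "\<dots> \<le> 2 * w * 1" using w w1 by (intro mult_left_mono power_le_one) auto
  also have "\<dots> \<le> 2 * real k * w" using w assms(1) by simp
  finally show ?thesis by (simp add: w_def)
qed

definition clip :: "real \<Rightarrow> real" where
  "clip r = max (- 1) (min 1 r)"

lemma abs_clip_le: "\<bar>clip r\<bar> \<le> 1"
  by (auto simp: clip_def)

lemma lipschitz_on_clip:
  assumes "L-lipschitz_on S f"
  shows "L-lipschitz_on S (\<lambda>x. clip (f x))"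
proof (rule lipschitz_onI)
  show "0 \<le> L" using assms by (rule lipschitz_on_nonneg)
  fix x y assume "x \<in> S" "y \<in> S"
  then have "dist (f x) (f y) \<le> L * dist x y" by (rule lipschitz_onD[OF assms])
  moreover have "dist (clip (f x)) (clip (f y)) \<le> dist (f x) (f y)"
    by (auto simp: clip_def dist_real_def)
  ultimately show "dist (clip (f x)) (clip (f y)) \<le> L * dist x y" by linarith
qed

lemma clip_diff_square_le:
  assumes "y \<in> {- 1..1}"
  shows "(y - clip r)\<^sup>2 \<le> (y - r)\<^sup>2"
  using assms by (intro abs_le_square_iff[THEN iffD1]) (auto simp: clip_def)

text \<open>Expand \<open>(y - F)^2\<close> around \<open>g\<close>, drop the square
  \<open>(F - g)^2\<close> and split \<open>F - g\<close> as \<open>- g + h + (F - h)\<close>. Cross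
  terms count twice, so the thresholds add up as \<open>1/6 + 2/6 + 2/8 + 2/8 = 1\<close>.\<close>

lemma square_loss_decomposition:
  fixes y g F h :: "nat \<Rightarrow> real"
  assumes "(\<Sum>i<n. (y i - F i)\<^sup>2) \<le> real n * (v - \<epsilon>)"
  defines "z \<equiv> \<lambda>i. y i - g i"
  shows "real n * (\<epsilon> / 6) \<le> (\<Sum>i<n. v - (z i)\<^sup>2) \<or>
    real n * (\<epsilon> / 6) \<le> (\<Sum>i<n. - (z i * g i)) \<or>
    real n * (\<epsilon> / 8) \<le> (\<Sum>i<n. z i * h i) \<or>
    real n * (\<epsilon> / 8) \<le> (\<Sum>i<n. z i * (F i - h i))"
proof (rule ccontr)
  assume "\<not> ?thesis"
  then have *: "(\<Sum>i<n. v - (z i)\<^sup>2) < real n * (\<epsilon> / 6)"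
    "(\<Sum>i<n. - (z i * g i)) < real n * (\<epsilon> / 6)"
    "(\<Sum>i<n. z i * h i) < real n * (\<epsilon> / 8)"
    "(\<Sum>i<n. z i * (F i - h i)) < real n * (\<epsilon> / 8)" by auto
  have "(\<Sum>i<n. v - (y i - F i)\<^sup>2) = (\<Sum>i<n. (v - (z i)\<^sup>2) + 2 * - (z i * g i) +
      2 * (z i * h i) + 2 * (z i * (F i - h i)) - (F i - g i)\<^sup>2)"
    by (intro sum.cong) (auto simp: z_def power2_eq_square algebra_simps)
  also have "\<dots> \<le> (\<Sum>i<n. (v - (z i)\<^sup>2) + 2 * - (z i * g i) +
      2 * (z i * h i) + 2 * (z i * (F i - h i)))"
    by (intro sum_mono) simp
  also have "\<dots> = (\<Sum>i<n. v - (z i)\<^sup>2) + 2 * (\<Sum>i<n. - (z i * g i)) +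
      2 * (\<Sum>i<n. z i * h i) + 2 * (\<Sum>i<n. z i * (F i - h i))"
    by (simp only: sum.distrib sum_distrib_left)
  also have "\<dots> < real n * \<epsilon>" using * by linarith
  finally show False using assms(1) by (simp add: sum_subtractf algebra_simps)
qed

text \<open>A linear functional on the cube of side \<open>[-1, 1]\<close> is largest at a vertex,
  namely the sign pattern of \<open>T\<close>.\<close>

lemma sum_mult_le_sign_sum:
  fixes m T :: "nat \<Rightarrow> real"
  assumes "\<And>l. l < k \<Longrightarrow> \<bar>m l\<bar> \<le> 1"
  shows "\<exists>S\<in>Pow {..<k}. (\<Sum>l<k. m l * T l) \<le> (\<Sum>l<k. (if l \<in> S then 1 else - 1) * T l)"
proof (rule bexI[where x = "{l\<in>{..<k}. T l \<ge> 0}"])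
  show "(\<Sum>l<k. m l * T l) \<le> (\<Sum>l<k. (if l \<in> {l\<in>{..<k}. T l \<ge> 0} then 1 else - 1) * T l)"
  proof (rule sum_mono)
    fix l assume l: "l \<in> {..<k}"
    have "m l * T l \<le> \<bar>m l\<bar> * \<bar>T l\<bar>" by (metis abs_ge_self abs_mult)
    also have "\<dots> \<le> 1 * \<bar>T l\<bar>" using assms l by (intro mult_right_mono) auto
    also have "\<dots> = (if l \<in> {l\<in>{..<k}. T l \<ge> 0} then 1 else - 1) * T l" using l by auto
    finally show "m l * T l \<le> \<dots>" .
  qed
qed auto

lemma abs_mult_le_two:
  fixes z u :: real
  assumes "\<bar>z\<bar> \<le> 2" "\<bar>u\<bar> \<le> 1"
  shows "z * u \<in> {- 2..2}" "- (z * u) \<in> {- 2..2}"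
proof -
  have "\<bar>z * u\<bar> \<le> 2 * 1" unfolding abs_mult using assms by (intro mult_mono) auto
  then show "z * u \<in> {- 2..2}" "- (z * u) \<in> {- 2..2}" by auto
qed

theorem mainTheorem3:
  fixes P :: "('a::euclidean_space \<times> real) measure"
    and \<mu>s :: "nat \<Rightarrow> 'a measure"
    and \<alpha> :: "nat \<Rightarrow> real"
    and k n :: nat
    and c L \<epsilon> :: real
    and \<F> :: "('a \<Rightarrow> real) set"
  assumes P_prob: "prob_space P"
    and P_sets: "sets P = sets borel"
    and y_bounded: "AE z in P. snd z \<in> {-1..1}"
    and mix_prob: "\<And>l. l < k \<Longrightarrow> prob_space (\<mu>s l)"
    and mix_sets: "\<And>l. l < k \<Longrightarrow> sets (\<mu>s l) = sets borel"
    and mix_iso: "\<And>l. l < k \<Longrightarrow> isoperimetric c (\<mu>s l)"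
    and \<alpha>_nonneg: "\<And>l. l < k \<Longrightarrow> \<alpha> l \<ge> 0"
    and \<alpha>_sum: "(\<Sum>l<k. \<alpha> l) = 1"
    and mixture: "\<And>A. A \<in> sets borel \<Longrightarrow>
        measure (distr P borel fst) A = (\<Sum>l<k. \<alpha> l * measure (\<mu>s l) A)"
    and \<sigma>_pos: "exp_cond_var P > 0"
    and L_pos: "L > 0"
    and \<epsilon>_pos: "\<epsilon> > 0"
    and \<F>_finite: "finite \<F>"
    and \<F>_lip: "\<And>f. f \<in> \<F> \<Longrightarrow> L-lipschitz_on UNIV f"
  shows "measure (PiM {..<n} (\<lambda>_. P))
           {\<omega> \<in> space (PiM {..<n} (\<lambda>_. P)).
              \<exists>f\<in>\<F>. (1 / real n) * (\<Sum>i<n. (snd (\<omega> i) - f (fst (\<omega> i)))\<^sup>2)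
                       \<le> exp_cond_var P - \<epsilon>}
         \<le> 4 * real k * exp (- (real n * \<epsilon>\<^sup>2) / (8 ^ 3 * real k))
           + 2 * exp (ln (real (card \<F>))
                      - (\<epsilon>\<^sup>2 * real n * real DIM('a)) / (10 ^ 4 * c * L\<^sup>2))"
proof (cases "4 * real k * exp (- (real n * \<epsilon>\<^sup>2) / (8 ^ 3 * real k)) \<ge> 1 \<or> c \<le> 0 \<or> \<F> = {}")

  \<comment> \<open>Degenerate cases\<close>
  case True
  interpret P: prob_space P by (rule P_prob)
  interpret \<Omega>: prob_space "PiM {..<n} (\<lambda>_. P)" by (intro prob_space_PiM P_prob)
  consider "4 * real k * exp (- (real n * \<epsilon>\<^sup>2) / (8 ^ 3 * real k)) \<ge> 1" | "c \<le> 0" "\<F> \<noteq> {}" | "\<F> = {}"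
    using True by auto
  then show ?thesis
  proof cases
    case 1
    then show ?thesis by (intro order_trans[OF \<Omega>.prob_le_1]) (auto intro: order_trans)
  next
    case 2
    \<comment> \<open>For \<open>c <= 0\<close> the subtracted quotient is nonpositive (0 at
      \<open>c = 0\<close> by the convention for division), so the second summand alone exceeds
      1.\<close>
    have "0 \<le> ln (real (card \<F>))" using 2 \<F>_finite by (intro ln_ge_zero) (simp add: Suc_le_eq card_gt_0_iff)
    moreover have "(\<epsilon>\<^sup>2 * real n * real DIM('a)) / (10 ^ 4 * c * L\<^sup>2) \<le> 0"
      using 2 by (intro divide_nonneg_nonpos) (auto simp: mult_nonpos_nonneg)
    ultimately have "1 \<le> exp (ln (real (card \<F>)) - (\<epsilon>\<^sup>2 * real n * real DIM('a)) / (10 ^ 4 * c * L\<^sup>2))"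
      by simp
    moreover have "0 \<le> 4 * real k * exp (- (real n * \<epsilon>\<^sup>2) / (8 ^ 3 * real k))" by simp
    ultimately show ?thesis by (intro order_trans[OF \<Omega>.prob_le_1]) linarith
  qed auto
next
  case False
  then have small: "4 * real k * exp (- (real n * \<epsilon>\<^sup>2) / (8 ^ 3 * real k)) < 1" and c: "c > 0"
    and \<F>: "\<F> \<noteq> {}" by auto
  interpret P: prob_space P by (rule P_prob)
  let ?\<Omega> = "PiM {..<n} (\<lambda>_. P)"
  interpret \<Omega>: prob_space ?\<Omega> by (intro prob_space_PiM P_prob)
  have k: "k \<ge> 1" using \<alpha>_sum by (cases k) auto
  \<comment> \<open>For \<open>n = 0\<close> the exponential is 1 and the left side of
    \<open>small\<close> is at least 4.\<close>
  have n: "n > 0" using small k by (cases n) auto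
  note [measurable_cong] = P_sets
  have sets_prod: "sets P = sets (borel \<Otimes>\<^sub>M borel)" by (metis P_sets borel_prod)
  have fst [measurable]: "fst \<in> P \<rightarrow>\<^sub>M borel" and snd [measurable]: "snd \<in> P \<rightarrow>\<^sub>M borel"
    using measurable_fst[of borel borel] measurable_snd[of borel borel] sets_prod
    by (simp_all cong: measurable_cong_sets)

  \<comment> \<open>Regression function and residual\<close>
  define G where "G = vimage_algebra (space P) fst (borel :: 'a measure)"
  interpret G: finite_measure_subalgebra P G
  proof
    show "subalgebra P G"
      unfolding subalgebra_def G_def
      using measurable_sets[OF fst] by (auto simp: sets_vimage_algebra2)
  qed
  have fst_G [measurable]: "fst \<in> G \<rightarrow>\<^sub>M borel"
    unfolding G_def by (rule measurable_vimage_algebra1) simp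

  define g where "g = real_cond_exp P G snd"
  define z where "z = (\<lambda>w. snd w - g w)"
  have g_G: "g \<in> borel_measurable G" by (simp add: g_def)
  have [measurable]: "g \<in> borel_measurable P" by (simp add: g_def)
  have [measurable]: "z \<in> borel_measurable P" by (simp add: z_def)
  have y_ge: "AE w in P. - 1 \<le> snd w" and y_le: "AE w in P. snd w \<le> 1"
    using y_bounded by simp_all
  have int_snd: "integrable P snd"
    by (rule P.integrable_const_bound[where B = 1]) (use y_ge y_le in \<open>eventually_elim; auto\<close>, simp)
  have g_bnd: "AE w in P. \<bar>g w\<bar> \<le> 1"
  proof -
    have "AE w in P. g w \<ge> - 1" unfolding g_def
      by (rule G.real_cond_exp_ge_c[OF int_snd y_ge])
    moreover have "AE w in P. g w \<le> 1" unfolding g_def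
      by (rule G.real_cond_exp_le_c[OF int_snd y_le])
    ultimately show ?thesis by eventually_elim auto
  qed
  have z_bnd: "AE w in P. \<bar>z w\<bar> \<le> 2"
    using g_bnd y_bounded by eventually_elim (auto simp: z_def)
  \<comment> \<open>The characterising property of conditional expectation; it centres every product
    of \<open>z\<close> with a bounded function of the covariate. The bound \<open>C\<close>
    provides integrability.\<close>
  have z_orth: "P.expectation (\<lambda>w. z w * u w) = 0"
    if u: "u \<in> borel_measurable G" and C: "AE w in P. \<bar>u w\<bar> \<le> C" for u C
  proof -
    have [measurable]: "u \<in> borel_measurable P" by (rule measurable_from_subalg[OF G.subalg u])
    have int: "integrable P (\<lambda>w. u w * snd w)"
    proof (rule P.integrable_const_bound[where B = C])
      show "AE w in P. norm (u w * snd w) \<le> C"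
        using C y_bounded
      proof eventually_elim
        case (elim w)
        have "\<bar>u w\<bar> * \<bar>snd w\<bar> \<le> C * 1" using elim by (intro mult_mono) auto
        then show ?case by (simp add: abs_mult)
      qed
    qed simp
    note cond = G.real_cond_exp_intg[OF int u snd, folded g_def]
    have "P.expectation (\<lambda>w. z w * u w) = P.expectation (\<lambda>w. u w * snd w - u w * g w)"
      by (simp add: z_def algebra_simps)
    also have "\<dots> = 0" using int cond by simp
    finally show ?thesis .
  qed

  \<comment> \<open>Soft labels for the mixture\<close>
  define \<mu> where "\<mu> = distr P borel fst"
  have \<mu>: "prob_space \<mu>" unfolding \<mu>_def by (rule P.prob_space_distr) simp
  have sets_\<mu> [measurable_cong]: "sets \<mu> = sets borel" by (simp add: \<mu>_def)
  have sets_\<mu>s: "sets (\<mu>s l) = sets \<mu>" if "l < k" for l using mix_sets[OF that] sets_\<mu> by simp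
  have mix: "measure \<mu> A = (\<Sum>l<k. \<alpha> l * measure (\<mu>s l) A)" if "A \<in> sets \<mu>" for A
    using mixture[of A] that sets_\<mu> by (simp add: \<mu>_def)
  obtain p :: "nat \<Rightarrow> 'a \<Rightarrow> real" where p: "\<And>l. p l \<in> borel_measurable \<mu>"
    and p0: "\<And>l x. 0 \<le> p l x" and p1: "AE x in \<mu>. (\<Sum>l<k. p l x) = 1"
    and p_int: "\<And>l \<phi>. l < k \<Longrightarrow> \<phi> \<in> borel_measurable \<mu> \<Longrightarrow>
       (\<integral>\<^sup>+x. ennreal (p l x) * \<phi> x \<partial>\<mu>) = ennreal (\<alpha> l) * (\<integral>\<^sup>+x. \<phi> x \<partial>\<mu>s l)"
  proof (rule mixture_weights[OF \<mu> mix_prob sets_\<mu>s \<alpha>_nonneg mix])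
    fix p :: "nat \<Rightarrow> 'a \<Rightarrow> real"
    assume *: "\<And>l. p l \<in> borel_measurable \<mu>" "\<And>l x. 0 \<le> p l x" "AE x in \<mu>. (\<Sum>l<k. p l x) = 1"
      "\<And>l \<phi>. l < k \<Longrightarrow> \<phi> \<in> borel_measurable \<mu> \<Longrightarrow>
         (\<integral>\<^sup>+x. ennreal (p l x) * \<phi> x \<partial>\<mu>) = ennreal (\<alpha> l) * (\<integral>\<^sup>+x. \<phi> x \<partial>\<mu>s l)"
    show thesis by (rule that[OF *])
  qed
  have [measurable]: "p l \<in> borel_measurable borel" for l
    using p[of l] by (simp add: sets_\<mu> cong: measurable_cong_sets)
  have p1_P: "AE w in P. (\<Sum>l<k. p l (fst w)) = 1"
    using AE_distrD[OF fst p1[unfolded \<mu>_def]] .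
  \<comment> \<open>The weights form a probability vector almost everywhere, so the bound is 1
    rather than \<open>k\<close>. It serves both the sign patterns and the function
    \<open>h\<close>.\<close>
  have comb_bnd: "AE w in P. \<bar>\<Sum>l<k. a l * p l (fst w)\<bar> \<le> 1" if a: "\<And>l. l < k \<Longrightarrow> \<bar>a l\<bar> \<le> 1" for a
    using p1_P
  proof eventually_elim
    case (elim w)
    have "\<bar>\<Sum>l<k. a l * p l (fst w)\<bar> \<le> (\<Sum>l<k. \<bar>a l * p l (fst w)\<bar>)" by (rule sum_abs)
    also have "\<dots> \<le> (\<Sum>l<k. 1 * p l (fst w))"
      using a p0 by (intro sum_mono) (auto simp: abs_mult intro!: mult_left_le_one_le)
    finally show ?case using elim by simp
  qed

  \<comment> \<open>The centred summands and their deviation events\<close>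
  define V where "V = exp_cond_var P"
  have V: "V = P.expectation (\<lambda>w. (z w)\<^sup>2)"
    by (simp add: V_def exp_cond_var_def z_def g_def G_def)
  define Ev where "Ev = (\<lambda>v t. {\<omega> \<in> space ?\<Omega>. real n * t \<le> (\<Sum>i<n. v (\<omega> i :: 'a \<times> real))})"
  have Ev_sets: "Ev v t \<in> sets ?\<Omega>" if [measurable]: "v \<in> borel_measurable P" for v t
    unfolding Ev_def by measurable

  define v1 where "v1 = (\<lambda>w. V - (z w)\<^sup>2)"
  define v2 where "v2 = (\<lambda>w. - (z w * g w))"
  (* Since |m f l| <= 1, the sum of z (h f) is dominated by one of the 2 ^ k sign combinations v3 S,
     uniformly in f; the 2 ^ k in the union bound is affordable, see sign_union_bound. *)
  define v3 where "v3 = (\<lambda>S w. z w * (\<Sum>l<k. (if l \<in> S then 1 else - 1) * p l (fst w)))"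
  define m where "m = (\<lambda>f l. \<integral>x. clip (f x) \<partial>\<mu>s l)"
  define h where "h = (\<lambda>f x. \<Sum>l<k. m f l * p l x)"
  define v4 where "v4 = (\<lambda>f w. z w * (clip (f (fst w)) - h f (fst w)))"
  have clip_meas: "(\<lambda>x. clip (f x)) \<in> borel_measurable borel" if "f \<in> \<F>" for f
    by (intro borel_measurable_continuous_onI lipschitz_on_continuous_on[OF lipschitz_on_clip[OF \<F>_lip[OF that]]])
  have [measurable]: "h f \<in> borel_measurable borel" for f by (simp add: h_def)
  have v1_meas [measurable]: "v1 \<in> borel_measurable P" by (simp add: v1_def)
  have v2_meas [measurable]: "v2 \<in> borel_measurable P" by (simp add: v2_def)
  have v3_meas [measurable]: "v3 S \<in> borel_measurable P" for S by (simp add: v3_def)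
  have v4_meas [measurable]: "v4 f \<in> borel_measurable P" if "f \<in> \<F>" for f
  proof -
    note [measurable] = clip_meas[OF that]
    show ?thesis by (simp add: v4_def)
  qed
  have m_bnd: "\<bar>m f l\<bar> \<le> 1" if "f \<in> \<F>" "l < k" for f l
  proof -
    interpret l: prob_space "\<mu>s l" by (rule mix_prob[OF that(2)])
    have meas: "(\<lambda>x. clip (f x)) \<in> borel_measurable (\<mu>s l)"
      using clip_meas[OF that(1)] mix_sets[OF that(2)] by (simp cong: measurable_cong_sets)
    have int: "integrable (\<mu>s l) (\<lambda>x. clip (f x))"
      by (rule l.integrable_const_bound[where B = 1]) (use meas abs_clip_le in auto)
    have "\<bar>m f l\<bar> \<le> l.expectation (\<lambda>x. \<bar>clip (f x)\<bar>)"
      unfolding m_def using integral_norm_bound[of "\<mu>s l" "\<lambda>x. clip (f x)"] by simp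
    also have "\<dots> \<le> l.expectation (\<lambda>x. 1)"
      using int by (intro integral_mono) (auto simp: abs_clip_le)
    finally show ?thesis by (simp add: l.prob_space)
  qed
  have \<epsilon>6: "\<epsilon> / 6 > 0" and \<epsilon>8: "\<epsilon> / 8 > 0" using \<epsilon>_pos by auto
  \<comment> \<open>The exponent from Hoeffding for \<open>v3\<close>, whose range has width 4:
    \<open>2 * (1/8)^2 / 4^2 = 1 / 8^3\<close>. The larger threshold for \<open>v1\<close> and
    \<open>v2\<close> gives the better constant \<open>1 / 288\<close>.\<close>
  define b where "b = real n * \<epsilon>\<^sup>2 / 8 ^ 3"
  have b0: "b \<ge> 0" by (simp add: b_def)

  \<comment> \<open>Hoeffding bounds for the terms shared by the whole class\<close>
  have "measure ?\<Omega> (Ev v1 (\<epsilon> / 6)) \<le> exp (- (2 * real n * (\<epsilon> / 6)\<^sup>2 / 4\<^sup>2))"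
    unfolding Ev_def
  proof (rule P.hoeffding_PiM[OF v1_meas _ _ _ _ \<epsilon>6])
    have sq: "AE w in P. (z w)\<^sup>2 \<le> 4"
      using z_bnd
    proof eventually_elim
      case (elim w)
      then have "\<bar>z w\<bar>\<^sup>2 \<le> 2\<^sup>2" by (intro power_mono) auto
      then show ?case by simp
    qed
    then show "AE w in P. v1 w \<in> {V - 4..V}" by eventually_elim (auto simp: v1_def)
    have "integrable P (\<lambda>w. (z w)\<^sup>2)"
      by (rule P.integrable_const_bound[where B = 4]) (use sq in auto)
    then show "P.expectation v1 = 0" unfolding v1_def by (simp add: V P.prob_space)
  qed simp_all
  also have "\<dots> \<le> exp (- b)" using b0 by (simp add: b_def field_simps)
  finally have bound1: "measure ?\<Omega> (Ev v1 (\<epsilon> / 6)) \<le> exp (- b)" .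

  have "measure ?\<Omega> (Ev v2 (\<epsilon> / 6)) \<le> exp (- (2 * real n * (\<epsilon> / 6)\<^sup>2 / 4\<^sup>2))"
    unfolding Ev_def
  proof (rule P.hoeffding_PiM[OF v2_meas _ _ _ _ \<epsilon>6])
    show "AE w in P. v2 w \<in> {- 2..2}"
      using z_bnd g_bnd by eventually_elim (unfold v2_def, rule abs_mult_le_two)
    show "P.expectation v2 = 0" unfolding v2_def using z_orth[OF g_G g_bnd] by simp
  qed simp_all
  also have "\<dots> \<le> exp (- b)" using b0 by (simp add: b_def field_simps)
  finally have bound2: "measure ?\<Omega> (Ev v2 (\<epsilon> / 6)) \<le> exp (- b)" .

  have bound3: "measure ?\<Omega> (Ev (v3 S) (\<epsilon> / 8)) \<le> exp (- b)" for S
  proof -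
    have bnd: "AE w in P. \<bar>\<Sum>l<k. (if l \<in> S then 1 else - 1) * p l (fst w)\<bar> \<le> 1"
      by (rule comb_bnd) auto
    have "measure ?\<Omega> (Ev (v3 S) (\<epsilon> / 8)) \<le> exp (- (2 * real n * (\<epsilon> / 8)\<^sup>2 / 4\<^sup>2))"
      unfolding Ev_def
    proof (rule P.hoeffding_PiM[OF v3_meas _ _ _ _ \<epsilon>8])
      show "AE w in P. v3 S w \<in> {- 2..2}"
        using z_bnd bnd by eventually_elim (unfold v3_def, rule abs_mult_le_two)
      show "P.expectation (v3 S) = 0" unfolding v3_def by (rule z_orth[OF _ bnd]) simp
    qed simp_all
    then show ?thesis by (simp add: b_def power_divide)
  qed

  \<comment> \<open>Subgaussian bound for each Lipschitz function\<close>
  define s where "s = c * L\<^sup>2 / real DIM('a)"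
  have s: "s > 0" using c L_pos by (simp add: s_def)
  define E where "E = (\<epsilon>\<^sup>2 * real n * real DIM('a)) / (10 ^ 4 * c * L\<^sup>2)"
  have bound4: "measure ?\<Omega> (Ev (v4 f) (\<epsilon> / 8)) \<le> exp (- E)" if f: "f \<in> \<F>" for f
  proof -
    note [measurable] = clip_meas[OF f]
    let ?u = "\<lambda>w. clip (f (fst w)) - h f (fst w)"
    have h_bnd: "AE w in P. \<bar>\<Sum>l<k. m f l * p l (fst w)\<bar> \<le> 1"
      by (rule comb_bnd) (rule m_bnd[OF f])
    have u_bnd: "AE w in P. \<bar>?u w\<bar> \<le> 2"
      using h_bnd
    proof eventually_elim
      case (elim w)
      then show ?case using abs_clip_le[of "f (fst w)"] by (simp add: h_def)
    qed
    have u_orth: "P.expectation (\<lambda>w. z w * ?u w) = 0" by (rule z_orth[OF _ u_bnd]) simp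
    have "(\<integral>\<^sup>+w. exp ((?u w)\<^sup>2 / (4 * s)) \<partial>P) = (\<integral>\<^sup>+x. exp ((clip (f x) - h f x)\<^sup>2 / (4 * s)) \<partial>\<mu>)"
      unfolding \<mu>_def by (subst nn_integral_distr) auto
    also have "\<dots> \<le> ennreal (exp 2)"
      unfolding h_def m_def
      by (rule mixture_exp_square_moment[where L = L and \<alpha> = \<alpha>, OF sets_\<mu> p p0 p1 p_int mix_prob
          mix_sets mix_iso \<alpha>_nonneg \<alpha>_sum lipschitz_on_clip[OF \<F>_lip[OF f]] abs_clip_le c L_pos s_def])
    finally have sub: "(\<integral>\<^sup>+w. exp ((?u w)\<^sup>2 / (4 * s)) \<partial>P) \<le> ennreal (exp 2)" .
    have mgf: "(\<integral>\<^sup>+w. exp (l * v4 f w) \<partial>P) \<le> ennreal (exp (36 * s * l\<^sup>2))" if "l > 0" for l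
      unfolding v4_def by (rule P.mgf_mult_subgaussian[OF _ _ z_bnd u_bnd u_orth s sub that]) simp_all
    have "measure ?\<Omega> (Ev (v4 f) (\<epsilon> / 8)) \<le> exp (- (real n * (\<epsilon> / 8)\<^sup>2 / (4 * (36 * s))))"
      unfolding Ev_def by (rule P.chernoff_PiM[OF v4_meas[OF f] mgf _ \<epsilon>8]) (use s in auto)
    \<comment> \<open>The constant is \<open>8^2 * 4 * 36 = 9216\<close>, rounded up to
      \<open>10^4\<close> below.\<close>
    also have "real n * (\<epsilon> / 8)\<^sup>2 / (4 * (36 * s)) = (real n * \<epsilon>\<^sup>2 / s) / 9216"
      by (simp add: power_divide)
    also have "exp (- ((real n * \<epsilon>\<^sup>2 / s) / 9216)) \<le> exp (- ((real n * \<epsilon>\<^sup>2 / s) / 10 ^ 4))"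
      using s by (simp add: field_simps)
    also have "(real n * \<epsilon>\<^sup>2 / s) / 10 ^ 4 = E"
      by (simp add: E_def s_def mult_ac)
    finally show ?thesis .
  qed

  \<comment> \<open>Union bound over all events\<close>
  let ?A = "Ev v1 (\<epsilon> / 6) \<union> Ev v2 (\<epsilon> / 6)"
  let ?B = "\<Union>S\<in>Pow {..<k}. Ev (v3 S) (\<epsilon> / 8)"
  let ?C = "\<Union>f\<in>\<F>. Ev (v4 f) (\<epsilon> / 8)"
  let ?bad = "{\<omega> \<in> space ?\<Omega>. \<exists>f\<in>\<F>. (1 / real n) * (\<Sum>i<n. (snd (\<omega> i) - f (fst (\<omega> i)))\<^sup>2) \<le> exp_cond_var P - \<epsilon>}"
  have A: "?A \<in> sets ?\<Omega>" by (intro sets.Un Ev_sets) simp_all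
  have B: "?B \<in> sets ?\<Omega>" by (intro sets.finite_UN Ev_sets) simp_all
  have C: "?C \<in> sets ?\<Omega>" using \<F>_finite by (intro sets.finite_UN Ev_sets) simp_all
  have y_\<Omega>: "AE \<omega> in ?\<Omega>. \<forall>i\<in>{..<n}. snd (\<omega> i) \<in> {- 1..1}"
    by (intro AE_finite_allI AE_PiM_component P_prob y_bounded) auto
  \<comment> \<open>The inclusion holds only almost everywhere, since clipping lowers the loss where
    all labels lie in \<open>[-1, 1]\<close>.\<close>
  have "measure ?\<Omega> ?bad \<le> measure ?\<Omega> (?A \<union> ?B \<union> ?C)"
  proof (rule \<Omega>.finite_measure_mono_AE)
    show "AE \<omega> in ?\<Omega>. \<omega> \<in> ?bad \<longrightarrow> \<omega> \<in> ?A \<union> ?B \<union> ?C"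
      using y_\<Omega>
    proof (eventually_elim, intro impI)
      fix \<omega> assume y: "\<forall>i\<in>{..<n}. snd (\<omega> i) \<in> {- 1..1}" and "\<omega> \<in> ?bad"
      then obtain f where \<omega>: "\<omega> \<in> space ?\<Omega>" and f: "f \<in> \<F>"
        and le: "(1 / real n) * (\<Sum>i<n. (snd (\<omega> i) - f (fst (\<omega> i)))\<^sup>2) \<le> V - \<epsilon>"
        by (auto simp: V_def)
      have "(\<Sum>i<n. (snd (\<omega> i) - clip (f (fst (\<omega> i))))\<^sup>2) \<le> (\<Sum>i<n. (snd (\<omega> i) - f (fst (\<omega> i)))\<^sup>2)"
        using y by (intro sum_mono clip_diff_square_le) auto
      also have "\<dots> \<le> real n * (V - \<epsilon>)" using le n by (simp add: field_simps)
      finally have *: "(\<Sum>i<n. (snd (\<omega> i) - clip (f (fst (\<omega> i))))\<^sup>2) \<le> real n * (V - \<epsilon>)" .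
      \<comment> \<open>Exhibits the empirical sum of \<open>z h\<close> as linear in the
        coefficients, so that a vertex of the cube can replace \<open>m f\<close>. The vertex may
        depend on the sample because \<open>?B\<close> contains all patterns.\<close>
      have swap: "(\<Sum>i<n. z (\<omega> i) * (\<Sum>l<k. a l * p l (fst (\<omega> i)))) =
          (\<Sum>l<k. a l * (\<Sum>i<n. z (\<omega> i) * p l (fst (\<omega> i))))" for a
        unfolding sum_distrib_left by (subst sum.swap) (simp add: mult_ac)
      obtain S where S: "S \<in> Pow {..<k}"
        and le_S: "(\<Sum>i<n. z (\<omega> i) * h f (fst (\<omega> i))) \<le> (\<Sum>i<n. v3 S (\<omega> i))"
        using sum_mult_le_sign_sum[where k = k and m = "m f", OF m_bnd[OF f],
          where T = "\<lambda>l. \<Sum>i<n. z (\<omega> i) * p l (fst (\<omega> i))"]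
        unfolding v3_def h_def swap by blast
      from square_loss_decomposition[OF *, of "\<lambda>i. g (\<omega> i)" "\<lambda>i. h f (fst (\<omega> i))"]
      have "\<omega> \<in> Ev v1 (\<epsilon> / 6) \<or> \<omega> \<in> Ev v2 (\<epsilon> / 6) \<or> \<omega> \<in> Ev (v3 S) (\<epsilon> / 8) \<or> \<omega> \<in> Ev (v4 f) (\<epsilon> / 8)"
        using \<omega> le_S by (auto simp: Ev_def v1_def v2_def v4_def z_def)
      then show "\<omega> \<in> ?A \<union> ?B \<union> ?C" using S f by blast
    qed
  qed (intro sets.Un A B C)
  also have "\<dots> \<le> measure ?\<Omega> ?A + measure ?\<Omega> ?B + measure ?\<Omega> ?C"
    using measure_Un_le[of "?A \<union> ?B" ?\<Omega> ?C] measure_Un_le[of ?A ?\<Omega> ?B] A B C by (meson add_right_mono order_trans sets.Un)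
  also have "measure ?\<Omega> ?A \<le> exp (- b) + exp (- b)"
    by (intro order_trans[OF measure_Un_le] add_mono bound1 bound2 Ev_sets) simp_all
  also have "measure ?\<Omega> ?B \<le> 2 ^ k * exp (- b)"
  proof -
    have "measure ?\<Omega> ?B \<le> (\<Sum>S\<in>Pow {..<k}. measure ?\<Omega> (Ev (v3 S) (\<epsilon> / 8)))"
      by (intro measure_UNION_le Ev_sets) simp_all
    also have "\<dots> \<le> (\<Sum>S\<in>Pow {..<k}. exp (- b))" by (intro sum_mono bound3)
    finally show ?thesis by (simp add: card_Pow)
  qed
  also have "measure ?\<Omega> ?C \<le> exp (ln (real (card \<F>)) - E)"
  proof -
    have "measure ?\<Omega> ?C \<le> (\<Sum>f\<in>\<F>. measure ?\<Omega> (Ev (v4 f) (\<epsilon> / 8)))"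
      using \<F>_finite by (intro measure_UNION_le Ev_sets) simp_all
    also have "\<dots> \<le> (\<Sum>f\<in>\<F>. exp (- E))" by (intro sum_mono bound4)
    also have "\<dots> = exp (ln (real (card \<F>)) - E)"
      using \<F> \<F>_finite by (simp add: exp_diff exp_minus card_gt_0_iff field_simps)
    finally show ?thesis .
  qed
  \<comment> \<open>The two single events and the sign patterns each contribute at most
    \<open>2 * k * exp (- b / k)\<close>; the sign patterns rely on \<open>small\<close>.\<close>
  also have "exp (- b) + exp (- b) + 2 ^ k * exp (- b) \<le> 4 * real k * exp (- b / real k)"
  proof -
    have "2 ^ k * exp (- b) \<le> 2 * real k * exp (- b / real k)"
      by (rule sign_union_bound[OF k]) (use small in \<open>simp add: b_def\<close>)
    moreover have "1 * exp (- b) \<le> real k * exp (- b / real k)"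
    proof (intro mult_mono)
      have "b / real k \<le> b" using b0 k by (simp add: divide_le_eq mult_le_cancel_left1)
      then show "exp (- b) \<le> exp (- b / real k)" by simp
    qed (use k in auto)
    ultimately show ?thesis by linarith
  qed
  also have "- b / real k = - (real n * \<epsilon>\<^sup>2) / (8 ^ 3 * real k)" by (simp add: b_def)
  finally show ?thesis unfolding E_def by (smt (verit) exp_gt_zero)
qed

end
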